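(* Let $G$ be a finite directed multigraph without loops on vertex set $\{1,\dots,n+1\}$ having a global sink at vertex $n+1$, with reduced Laplacian $\Delta$. Let $\mathbf a$ be a critical configuration and let $\mathbf b$ be a stable configuration linearly equivalent to $\mathbf a$. Then $w(\mathbf a)\ge w(\mathbf b)$, where $w(\mathbf x)=\sum_{i=1}^n x_i$.
   Context: $G=(V,E)$ is a directed multigraph without loops, $V=\{1,\dots,n+1\}$; $d^+_i$ is the out-degree of $i$ and $e_{i,j}$ the number of edges from $i$ to $j$. Vertex $n+1$ is a global sink: it has no out-going edges and every other vertex has a directed path to it. The reduced Laplacian $\Delta\in\mathbb Z^{n\times n}$ has $\Delta_{ii}=d^+_i$ and $\Delta_{ij}=-e_{i,j}$ for $i\ne j$ ($i,j\le n$); $\Delta_i$ is its $i$-th row. Vectors are row vectors. A configuration is a vector in $\mathbb Z^n$. Two configurations $\mathbf a,\mathbf b$ are linearly equivalent if $\mathbf b=\mathbf a-\sigma\Delta$ for some $\sigma\in\mathbb Z^n$. Vertex $i$ is active in $\mathbf a$ if $a_i\ge d^+_i$; firing it gives $\mathbf a-\Delta_i$. A firing sequence is legal if each fired vertex is active when it fires. A stable configuration is a non-negative configuration with no active vertex. For non-negative $\mathbf a$, $\mathbf a^\circ$ denotes the unique stable configuration reachable from $\mathbf a$ by a legal firing sequence. A non-negative configuration $\mathbf a$ is critical if for every configuration $\mathbf b$ there exists a non-negative configuration $\mathbf c$ with $\mathbf b+\mathbf c$ non-negative and $\mathbf a=(\mathbf b+\mathbf c)^\circ$. *)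

theory Defs
  imports "Graph_Theory.Digraph" "Jordan_Normal_Form.Matrix"
begin

text \<open>
  A directed multigraph is a \<^typ>\<open>(nat, 'e) pre_digraph\<close>, with parallel arcs allowed; its vertex
  set is \<^term>\<open>{1..n + 1}\<close> for a number \<^term>\<open>n\<close> that is passed explicitly. Configurations are the
  elements of \<^term>\<open>carrier_vec n :: int vec set\<close>. Since vectors and matrices are indexed from
  \<^term>\<open>0::nat\<close>, coordinate \<^term>\<open>i\<close> with \<^term>\<open>i < n\<close> belongs to the vertex \<^term>\<open>i + 1\<close>.
\<close>

definition edge_mult :: "('v, 'e) pre_digraph \<Rightarrow> 'v \<Rightarrow> 'v \<Rightarrow> nat" where
  "edge_mult G u v = card {e \<in> arcs G. tail G e = u \<and> head G e = v}"

definition global_sink :: "('v, 'e) pre_digraph \<Rightarrow> 'v \<Rightarrow> bool" where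
  "global_sink G s \<longleftrightarrow>
     s \<in> verts G \<and> out_arcs G s = {} \<and> (\<forall>v \<in> verts G. v \<noteq> s \<longrightarrow> v \<rightarrow>\<^sup>*\<^bsub>G\<^esub> s)"

definition reduced_laplacian :: "(nat, 'e) pre_digraph \<Rightarrow> nat \<Rightarrow> int mat" where
  "reduced_laplacian G n = mat n n (\<lambda>(i, j).
     if i = j then int (out_degree G (i + 1)) else - int (edge_mult G (i + 1) (j + 1)))"

text \<open>The row vector \<open>\<sigma> \<Delta>\<close> is written as the transpose of \<open>\<Delta>\<close> applied to \<open>\<sigma>\<close>.\<close>

definition linearly_equivalent :: "(nat, 'e) pre_digraph \<Rightarrow> nat \<Rightarrow> int vec \<Rightarrow> int vec \<Rightarrow> bool" where
  "linearly_equivalent G n a b \<longleftrightarrow>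
     (\<exists>\<sigma> \<in> carrier_vec n. b = a - transpose_mat (reduced_laplacian G n) *\<^sub>v \<sigma>)"

definition nonneg_config :: "nat \<Rightarrow> int vec \<Rightarrow> bool" where
  "nonneg_config n a \<longleftrightarrow> a \<in> carrier_vec n \<and> (\<forall>i < n. 0 \<le> a $ i)"

definition active :: "(nat, 'e) pre_digraph \<Rightarrow> int vec \<Rightarrow> nat \<Rightarrow> bool" where
  "active G a i \<longleftrightarrow> int (out_degree G (i + 1)) \<le> a $ i"

definition fire :: "(nat, 'e) pre_digraph \<Rightarrow> nat \<Rightarrow> nat \<Rightarrow> int vec \<Rightarrow> int vec" where
  "fire G n i a = a - row (reduced_laplacian G n) i"

fun legal :: "(nat, 'e) pre_digraph \<Rightarrow> nat \<Rightarrow> int vec \<Rightarrow> nat list \<Rightarrow> bool" where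
  "legal G n a [] \<longleftrightarrow> True"
| "legal G n a (i # is) \<longleftrightarrow> i < n \<and> active G a i \<and> legal G n (fire G n i a) is"

definition stable_config :: "(nat, 'e) pre_digraph \<Rightarrow> nat \<Rightarrow> int vec \<Rightarrow> bool" where
  "stable_config G n a \<longleftrightarrow> nonneg_config n a \<and> (\<forall>i < n. \<not> active G a i)"

definition stabilization :: "(nat, 'e) pre_digraph \<Rightarrow> nat \<Rightarrow> int vec \<Rightarrow> int vec" where
  "stabilization G n a =
     (THE b. stable_config G n b \<and> (\<exists>is. legal G n a is \<and> b = fold (fire G n) is a))"

definition critical :: "(nat, 'e) pre_digraph \<Rightarrow> nat \<Rightarrow> int vec \<Rightarrow> bool" where
  "critical G n a \<longleftrightarrow> nonneg_config n a \<and>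
     (\<forall>b \<in> carrier_vec n. \<exists>c. nonneg_config n c \<and> nonneg_config n (b + c) \<and>
        a = stabilization G n (b + c))"

definition weight :: "int vec \<Rightarrow> int" where
  "weight x = (\<Sum>i < dim_vec x. x $ i)"

end

theory Submission
  imports Defs "Jordan_Normal_Form.Determinant"
begin

text \<open>
  Write \<open>b = a - \<sigma> \<Delta>\<close>; firing a vertex never increases the weight, so it suffices that \<open>\<sigma> \<ge> 0\<close>.
  Criticality applied to \<open>b\<close> itself gives \<open>c \<ge> 0\<close> and a legal firing vector \<open>f\<close> with
  \<open>a = b + c - f \<Delta>\<close>. Hence \<open>(f + \<sigma>) \<Delta> = c \<ge> 0\<close>, and as \<open>\<Delta>\<close> has a non-negative inverse,
  \<open>f + \<sigma> \<ge> 0\<close>. Since \<open>b = (b + c) - (f + \<sigma>) \<Delta>\<close> is stable, the least action principle yields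
  \<open>f \<le> f + \<sigma>\<close>, that is \<open>\<sigma> \<ge> 0\<close>.
\<close>

locale sandpile = fin_digraph G for G :: "(nat, 'e) pre_digraph" +
  fixes n :: nat
  assumes verts_eq: "verts G = {1..n + 1}" and sink: "global_sink G (n + 1)"
begin

section \<open>The reduced Laplacian as a linear map on firing vectors\<close>

abbreviation "\<Delta> \<equiv> reduced_laplacian G n"

definition laplace :: "int vec \<Rightarrow> int vec" where
  "laplace g = transpose_mat \<Delta> *\<^sub>v g"

definition firing_vec :: "nat list \<Rightarrow> int vec" where
  "firing_vec is = vec n (\<lambda>i. int (count_list is i))"

lemma laplacian_carrier [simp]: "\<Delta> \<in> carrier_mat n n"
  by (simp add: reduced_laplacian_def)

lemma laplacian_dim [simp]: "dim_row \<Delta> = n" "dim_col \<Delta> = n"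
  by (simp_all add: reduced_laplacian_def)

lemma firing_vec_carrier [simp]: "firing_vec is \<in> carrier_vec n"
  by (simp add: firing_vec_def)

lemma firing_vec_dim [simp]: "dim_vec (firing_vec is) = n"
  by (simp add: firing_vec_def)

lemma laplace_dim [simp]: "dim_vec (laplace g) = n"
  by (simp add: laplace_def)

lemma laplace_carrier [simp]: "laplace g \<in> carrier_vec n"
  by (rule carrier_vecI) simp

lemma laplace_nth:
  assumes "g \<in> carrier_vec n" "j < n"
  shows "laplace g $ j = (\<Sum>k<n. g $ k * \<Delta> $$ (k, j))"
proof -
  have "laplace g $ j = (\<Sum>k<n. \<Delta> $$ (k, j) * g $ k)"
    using assms by (simp add: laplace_def scalar_prod_def atLeast0LessThan)
  then show ?thesis by (simp only: mult.commute)
qed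

lemma laplace_add:
  "g \<in> carrier_vec n \<Longrightarrow> h \<in> carrier_vec n \<Longrightarrow> laplace (g + h) = laplace g + laplace h"
  unfolding laplace_def by (rule mult_add_distrib_mat_vec) auto

lemma laplace_minus:
  "g \<in> carrier_vec n \<Longrightarrow> h \<in> carrier_vec n \<Longrightarrow> laplace (g - h) = laplace g - laplace h"
  unfolding laplace_def by (rule mult_minus_distrib_mat_vec) auto

lemma laplace_uminus: "g \<in> carrier_vec n \<Longrightarrow> laplace (- g) = - laplace g"
  by (rule eq_vecI) (auto simp: laplace_nth sum_negf)

lemma laplace_unit_vec: "i < n \<Longrightarrow> laplace (unit_vec n i) = row \<Delta> i"
  unfolding laplace_def by (rule eq_vecI) auto

lemma laplacian_diag: "i < n \<Longrightarrow> \<Delta> $$ (i, i) = int (out_degree G (i + 1))"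
  by (simp add: reduced_laplacian_def)

lemma laplacian_off_diag: "i < n \<Longrightarrow> j < n \<Longrightarrow> i \<noteq> j \<Longrightarrow> \<Delta> $$ (i, j) \<le> 0"
  by (simp add: reduced_laplacian_def)

section \<open>Partial row sums and non-negativity of the inverse\<close>

text \<open>The diagonal entry counts all arcs out of \<open>i + 1\<close>, and the other entries
  with column in \<open>S\<close> remove only arcs that end in \<open>S\<close>. The arcs leaving
  \<open>S\<close> are never removed.\<close>

lemma sum_laplacian_ge_leaving_arcs:
  assumes S: "S \<subseteq> {..<n}" and i: "i \<in> S"
  shows "(\<Sum>j\<in>S. \<Delta> $$ (i, j)) \<ge> int (card {e \<in> out_arcs G (i + 1). head G e \<notin> Suc ` S})"
proof -
  have fS: "finite S" using S finite_subset by blast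
  have iN: "i < n" using S i by auto
  define A where "A j = {e \<in> arcs G. tail G e = i + 1 \<and> head G e = j + 1}" for j
  let ?L = "{e \<in> out_arcs G (i + 1). head G e \<notin> Suc ` S}"
  have fA: "finite (A j)" for j unfolding A_def by simp
  have "(\<Sum>j\<in>S. \<Delta> $$ (i, j)) = \<Delta> $$ (i, i) + (\<Sum>j\<in>S - {i}. \<Delta> $$ (i, j))"
    using fS i by (simp add: sum.remove)
  also have "(\<Sum>j\<in>S - {i}. \<Delta> $$ (i, j)) = (\<Sum>j\<in>S - {i}. - int (card (A j)))"
    using S iN by (intro sum.cong) (auto simp: reduced_laplacian_def edge_mult_def A_def)
  also have "\<dots> = - int (card (\<Union>j\<in>S - {i}. A j))"
    using fS fA by (subst card_UN_disjoint) (auto simp: A_def sum_negf)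
  finally have eq: "(\<Sum>j\<in>S. \<Delta> $$ (i, j)) = int (out_degree G (i + 1)) - int (card (\<Union>j\<in>S - {i}. A j))"
    using laplacian_diag[OF iN] by simp
  have "card ?L + card (\<Union>j\<in>S - {i}. A j) = card (?L \<union> (\<Union>j\<in>S - {i}. A j))"
    using fS fA by (subst card_Un_disjoint) (auto simp: A_def out_arcs_def)
  also have "\<dots> \<le> out_degree G (i + 1)"
    unfolding out_degree_def by (rule card_mono) (auto simp: A_def out_arcs_def)
  finally show ?thesis using eq by simp
qed

lemma sum_laplacian_nonneg:
  assumes "S \<subseteq> {..<n}" "i \<in> S"
  shows "(\<Sum>j\<in>S. \<Delta> $$ (i, j)) \<ge> 0"
  using sum_laplacian_ge_leaving_arcs[OF assms] by linarith

text \<open>A path to the sink from a vertex of \<open>S\<close> has to leave \<open>S\<close>, as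
  the sink \<open>n + 1\<close> is outside. \<open>Suc\<close> turns coordinates into
  vertices.\<close>

lemma exists_leaving_arc:
  assumes S: "S \<subseteq> {..<n}" and "S \<noteq> {}"
  obtains i e where "i \<in> S" "e \<in> out_arcs G (i + 1)" "head G e \<notin> Suc ` S"
proof -
  obtain v where v: "v \<in> S" using assms by auto
  have "Suc v \<rightarrow>\<^sup>*\<^bsub>G\<^esub> (n + 1)"
    using sink v S verts_eq unfolding global_sink_def by force
  \<comment> \<open>The implication makes the base case at the sink vacuous. For an arc from
    \<open>x\<close> to \<open>y\<close>, either \<open>y\<close> is still inside and the induction
    hypothesis applies, or this arc is the one that leaves.\<close>
  then have "Suc v \<in> Suc ` S \<longrightarrow> (\<exists>u w. u \<in> Suc ` S \<and> w \<notin> Suc ` S \<and> u \<rightarrow>\<^bsub>G\<^esub> w)"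
  proof (induction rule: converse_reachable_induct)
    case base
    then show ?case using S by auto
  next
    case (step x y)
    then show ?case by blast
  qed
  then obtain u w where "u \<in> Suc ` S" "w \<notin> Suc ` S" "u \<rightarrow>\<^bsub>G\<^esub> w" using v by blast
  then show ?thesis using that by (auto simp: arcs_ends_def arc_to_ends_def out_arcs_def)
qed

text \<open>Summing \<open>g \<Delta>\<close> over the vertices where \<open>g\<close> is negative gives a non-positive number, which
  vanishes only if no arc leaves this set of vertices.\<close>

lemma laplace_inverse_nonneg:
  assumes g: "g \<in> carrier_vec n" and pos: "\<And>j. j < n \<Longrightarrow> 0 \<le> laplace g $ j"
    and i: "i < n"
  shows "0 \<le> g $ i"
proof (rule ccontr)
  assume neg: "\<not> 0 \<le> g $ i"
  define S where "S = {k. k < n \<and> g $ k < 0}"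
  have S: "S \<subseteq> {..<n}" "S \<noteq> {}" using neg i by (auto simp: S_def)
  obtain i0 e where e: "i0 \<in> S" "e \<in> out_arcs G (i0 + 1)" "head G e \<notin> Suc ` S"
    using exists_leaving_arc[OF S] .
  let ?r = "\<lambda>k. \<Sum>j\<in>S. \<Delta> $$ (k, j)"
  \<comment> \<open>For \<open>k\<close> in \<open>S\<close> a negative entry of \<open>g\<close>
    meets a non-negative partial row sum. For \<open>k\<close> outside \<open>S\<close> a
    non-negative entry meets a sum of off-diagonal entries.\<close>
  have le: "g $ k * ?r k \<le> 0" if k: "k < n" for k
  proof (cases "k \<in> S")
    case True
    then show ?thesis using sum_laplacian_nonneg[OF S(1) True]
      by (auto simp: S_def mult_le_0_iff)
  next
    case False
    then have "?r k \<le> 0" using k S by (intro sum_nonpos laplacian_off_diag) auto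
    then show ?thesis using False k by (auto simp: S_def mult_le_0_iff)
  qed
  have "finite {e \<in> out_arcs G (i0 + 1). head G e \<notin> Suc ` S}" by (simp add: out_arcs_def)
  then have "card {e \<in> out_arcs G (i0 + 1). head G e \<notin> Suc ` S} > 0"
    using e by (auto simp: card_gt_0_iff)
  then have "?r i0 > 0" using sum_laplacian_ge_leaving_arcs[OF S(1) e(1)] by linarith
  then have lt: "g $ i0 * ?r i0 < 0" using e(1) by (auto simp: S_def mult_less_0_iff)
  have "0 \<le> (\<Sum>j\<in>S. laplace g $ j)" using S pos by (intro sum_nonneg) auto
  also have "\<dots> = (\<Sum>j\<in>S. \<Sum>k<n. g $ k * \<Delta> $$ (k, j))"
    using S g by (intro sum.cong) (auto simp: laplace_nth)
  also have "\<dots> = (\<Sum>k<n. g $ k * ?r k)"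
    by (subst sum.swap) (simp add: sum_distrib_left)
  also have "\<dots> < (\<Sum>k<n. 0)"
    using le lt e(1) S by (intro sum_strict_mono_ex1) auto
  finally show False by simp
qed

section \<open>Nonsingularity and large elements of the lattice of \<open>\<Delta>\<close>\<close>

text \<open>If \<open>v\<close> is in the kernel, then both \<open>v\<close> and \<open>- v\<close>
  have a non-negative image, so both are non-negative and \<open>v\<close> vanishes.\<close>

lemma det_laplacian_nonzero: "det (transpose_mat \<Delta>) \<noteq> 0"
proof
  assume "det (transpose_mat \<Delta>) = 0"
  then obtain v where v: "v \<in> carrier_vec n" "v \<noteq> 0\<^sub>v n" "laplace v = 0\<^sub>v n"
    unfolding laplace_def using det_0_iff_vec_prod_zero[of "transpose_mat \<Delta>" n] by auto
  have "v $ i = 0" if i: "i < n" for i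
  proof -
    have "0 \<le> v $ i" using laplace_inverse_nonneg[OF v(1) _ i] v(3) by simp
    moreover have "0 \<le> (- v) $ i" using laplace_inverse_nonneg[of "- v", OF _ _ i] v(1,3) by (simp add: laplace_uminus)
    ultimately show ?thesis using v i by auto
  qed
  then show False using v(1,2) eq_vecI[of v "0\<^sub>v n"] by simp
qed

lemma exists_dominating_laplace:
  assumes x: "nonneg_config n x"
  obtains g where "g \<in> carrier_vec n" "\<And>j. j < n \<Longrightarrow> x $ j \<le> laplace g $ j"
proof -
  let ?T = "transpose_mat \<Delta>"
  let ?d = "det ?T"
  have xc: "x \<in> carrier_vec n" using x by (simp add: nonneg_config_def)
  have T: "?T \<in> carrier_mat n n" by simp
  \<comment> \<open>The adjugate replaces the inverse so that \<open>g\<close> stays integral. The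
    sign factor turns the determinant into its absolute value, which is at least 1.\<close>
  define g where "g = adj_mat ?T *\<^sub>v (sgn ?d \<cdot>\<^sub>v x)"
  have gc: "g \<in> carrier_vec n" unfolding g_def using mult_mat_vec_carrier[OF adj_mat(1)[OF T]] xc by simp
  have "laplace g = (?T * adj_mat ?T) *\<^sub>v (sgn ?d \<cdot>\<^sub>v x)"
    unfolding laplace_def g_def using xc
    by (subst assoc_mult_mat_vec[OF T adj_mat(1)[OF T]]) simp_all
  also have "\<dots> = (?d \<cdot>\<^sub>m 1\<^sub>m n) *\<^sub>v (sgn ?d \<cdot>\<^sub>v x)" using adj_mat(2)[OF T] by simp
  also have "\<dots> = \<bar>?d\<bar> \<cdot>\<^sub>v x"
    using xc by (intro eq_vecI) (auto simp: abs_sgn)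
  finally have lap: "laplace g = \<bar>?d\<bar> \<cdot>\<^sub>v x" .
  have "x $ j \<le> laplace g $ j" if j: "j < n" for j
  proof -
    have "0 \<le> x $ j" using x j by (simp add: nonneg_config_def)
    moreover have "1 \<le> \<bar>?d\<bar>" using det_laplacian_nonzero by linarith
    ultimately have "1 * x $ j \<le> \<bar>?d\<bar> * x $ j" by (intro mult_right_mono) auto
    then show ?thesis using lap j xc by simp
  qed
  then show ?thesis using that gc by blast
qed

section \<open>Firing and legal sequences\<close>

lemma fire_eq: "i < n \<Longrightarrow> fire G n i x = x - laplace (unit_vec n i)"
  by (simp add: fire_def laplace_unit_vec)

lemma fire_carrier [simp]: "x \<in> carrier_vec n \<Longrightarrow> i < n \<Longrightarrow> fire G n i x \<in> carrier_vec n"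
  by (simp add: fire_eq)

text \<open>Only the fired vertex can lose chips. It loses its out-degree, which it holds because it
  is active.\<close>

lemma fire_nonneg:
  assumes x: "nonneg_config n x" and i: "i < n" "active G x i"
  shows "nonneg_config n (fire G n i x)"
proof -
  have "0 \<le> fire G n i x $ j" if j: "j < n" for j
  proof -
    have "fire G n i x $ j = x $ j - \<Delta> $$ (i, j)"
      using i j by (simp add: fire_def)
    then show ?thesis
      using x i j laplacian_diag[of i] laplacian_off_diag[of i j]
      by (cases "i = j") (force simp: nonneg_config_def active_def)+
  qed
  then show ?thesis using x i by (simp add: nonneg_config_def)
qed

lemma legal_fold_nonneg:
  "legal G n x is \<Longrightarrow> nonneg_config n x \<Longrightarrow> nonneg_config n (fold (fire G n) is x)"
  by (induction "is" arbitrary: x) (auto simp: fire_nonneg)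

lemma legal_append:
  "legal G n x (is @ js) \<longleftrightarrow> legal G n x is \<and> legal G n (fold (fire G n) is x) js"
  by (induction "is" arbitrary: x) auto

lemma firing_vec_Cons: "i < n \<Longrightarrow> firing_vec (i # is) = unit_vec n i + firing_vec is"
  by (rule eq_vecI) (auto simp: firing_vec_def)

lemma fold_fire:
  "legal G n x is \<Longrightarrow> x \<in> carrier_vec n \<Longrightarrow> fold (fire G n) is x = x - laplace (firing_vec is)"
proof (induction "is" arbitrary: x)
  case Nil
  have "laplace (firing_vec []) = 0\<^sub>v n"
    by (rule eq_vecI) (auto simp: laplace_nth firing_vec_def)
  then show ?case using Nil by simp
next
  case (Cons i "is")
  then have i: "i < n" by simp
  have "fold (fire G n) (i # is) x = x - laplace (unit_vec n i) - laplace (firing_vec is)"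
    using Cons.IH[of "fire G n i x"] Cons.prems i by (simp add: fire_eq[OF i])
  also have "\<dots> = x - laplace (firing_vec (i # is))"
    using Cons.prems i by (intro eq_vecI) (auto simp: firing_vec_Cons laplace_add)
  finally show ?case .
qed

section \<open>The least action principle\<close>

text \<open>The competitor \<open>g\<close> need not come from a legal sequence, nor must
  \<open>x - laplace g\<close> be non-negative. By induction, \<open>g\<close> must fire the first
  vertex of the sequence at least once, and one such firing is removed from both sides.\<close>

lemma legal_firing_vec_le:
  assumes "legal G n x is" "x \<in> carrier_vec n" "g \<in> carrier_vec n"
    and "\<And>j. j < n \<Longrightarrow> 0 \<le> g $ j" "\<And>j. j < n \<Longrightarrow> \<not> active G (x - laplace g) j" "k < n"
  shows "firing_vec is $ k \<le> g $ k"
  using assms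
proof (induction "is" arbitrary: x g)
  case Nil
  then show ?case by (simp add: firing_vec_def)
next
  case (Cons i "is")
  then have i: "i < n" and act: "active G x i" by auto
  \<comment> \<open>If \<open>g\<close> never fired \<open>i\<close>, the other firings could only
    add chips at \<open>i\<close>, so the active vertex \<open>i\<close> would remain
    active.\<close>
  have "g $ i \<noteq> 0"
  proof
    assume z: "g $ i = 0"
    have "laplace g $ i = (\<Sum>k<n. g $ k * \<Delta> $$ (k, i))" using Cons.prems i by (simp add: laplace_nth)
    also have "\<dots> \<le> 0"
    proof (rule sum_nonpos)
      fix k assume "k \<in> {..<n}"
      then show "g $ k * \<Delta> $$ (k, i) \<le> 0"
        using z i Cons.prems(4)[of k] laplacian_off_diag[of k i]
        by (cases "k = i") (auto simp: mult_le_0_iff)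
    qed
    finally have "active G (x - laplace g) i"
      using act i Cons.prems(2) by (simp add: active_def)
    then show False using Cons.prems(5) i by blast
  qed
  then have gi: "1 \<le> g $ i" using Cons.prems(4)[OF i] by linarith
  let ?g = "g - unit_vec n i"
  have eq: "fire G n i x - laplace ?g = x - laplace g"
    using Cons.prems i by (intro eq_vecI) (auto simp: fire_eq laplace_minus)
  have "firing_vec is $ k \<le> ?g $ k"
  proof (rule Cons.IH)
    show "0 \<le> ?g $ j" if "j < n" for j
      using that gi Cons.prems(3,4) i by (cases "j = i") auto
    show "\<not> active G (fire G n i x - laplace ?g) j" if "j < n" for j
      unfolding eq using Cons.prems(5) that by blast
  qed (use Cons.prems i in auto)
  then show ?case using Cons.prems i by (simp add: firing_vec_Cons)
qed

lemma length_legal: "legal G n x is \<Longrightarrow> int (length is) = (\<Sum>k<n. firing_vec is $ k)"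
proof -
  assume "legal G n x is"
  then have "set is \<subseteq> {..<n}" by (induction "is" arbitrary: x) auto
  then have "(\<Sum>k<n. count_list is k) = length is" by (rule sum_count_set) simp
  then show ?thesis by (simp add: firing_vec_def flip: of_nat_sum)
qed

section \<open>Existence and uniqueness of the stabilization\<close>

text \<open>Least action bounds the length of every legal sequence by the entry sum of one fixed
  \<open>g\<close>, and a longest legal sequence cannot end with an active vertex.\<close>

lemma exists_stabilizing_sequence:
  assumes x: "nonneg_config n x"
  obtains "is" where "legal G n x is" "stable_config G n (fold (fire G n) is x)"
proof -
  have xc: "x \<in> carrier_vec n" using x by (simp add: nonneg_config_def)
  \<comment> \<open>Adding 1 everywhere makes every entry of \<open>x - laplace g\<close> negative,
    hence smaller than any out-degree.\<close>
  define y where "y = x + vec n (\<lambda>_. 1)"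
  have y: "nonneg_config n y" using x by (auto simp: nonneg_config_def y_def)
  obtain g where g: "g \<in> carrier_vec n" "\<And>j. j < n \<Longrightarrow> y $ j \<le> laplace g $ j"
    using exists_dominating_laplace[OF y] by blast
  have gpos: "0 \<le> g $ j" if "j < n" for j
    using laplace_inverse_nonneg[OF g(1) _ that] g(2) y order_trans
    unfolding nonneg_config_def by blast
  have nact: "\<not> active G (x - laplace g) j" if "j < n" for j
    using g(2)[OF that] that xc by (simp add: active_def y_def)
  define P where "P is \<longleftrightarrow> legal G n x is" for "is"
  have bound: "length is \<le> nat (\<Sum>k<n. g $ k)" if "P is" for "is"
  proof -
    have l: "legal G n x is" using that by (simp add: P_def)
    have "int (length is) \<le> (\<Sum>k<n. g $ k)"
      unfolding length_legal[OF l]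
      by (intro sum_mono legal_firing_vec_le[OF l xc g(1) gpos nact]) auto
    then show ?thesis by linarith
  qed
  have "P []" by (simp add: P_def)
  then obtain "is" where "is": "P is" "\<And>js. P js \<Longrightarrow> length js \<le> length is"
    using ex_has_greatest_nat[of P "[]" length] bound by (metis le_imp_less_Suc)
  let ?s = "fold (fire G n) is x"
  have "\<not> active G ?s i" if i: "i < n" for i
  proof
    assume "active G ?s i"
    then have "P (is @ [i])" using "is"(1) i by (simp add: P_def legal_append)
    then show False using "is"(2) by fastforce
  qed
  then have "stable_config G n ?s"
    using legal_fold_nonneg "is"(1) x by (auto simp: stable_config_def P_def)
  then show ?thesis using that "is"(1) by (auto simp: P_def)
qed

text \<open>Least action with the firing vector of \<open>js\<close> as competitor. Used in both
  directions, it shows that all stabilizing sequences have the same firing vector.\<close>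

lemma stable_firing_vec_le:
  assumes x: "nonneg_config n x" and l: "legal G n x is"
    and l': "legal G n x js" and s: "stable_config G n (fold (fire G n) js x)"
    and k: "k < n"
  shows "firing_vec is $ k \<le> firing_vec js $ k"
proof -
  have xc: "x \<in> carrier_vec n" using x by (simp add: nonneg_config_def)
  have "\<not> active G (x - laplace (firing_vec js)) j" if "j < n" for j
    using s that unfolding fold_fire[OF l' xc] stable_config_def by blast
  moreover have "0 \<le> firing_vec js $ j" if "j < n" for j
    using that by (simp add: firing_vec_def)
  ultimately show ?thesis using legal_firing_vec_le[OF l xc firing_vec_carrier _ _ k] by blast
qed

lemma stabilization_legal:
  assumes x: "nonneg_config n x"
  obtains "is" where "legal G n x is" "stabilization G n x = x - laplace (firing_vec is)"
proof -
  have xc: "x \<in> carrier_vec n" using x by (simp add: nonneg_config_def)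
  obtain "is" where "is": "legal G n x is" "stable_config G n (fold (fire G n) is x)"
    using exists_stabilizing_sequence[OF x] .
  have "stabilization G n x = fold (fire G n) is x"
    unfolding stabilization_def
  proof (rule the_equality)
    fix b assume "stable_config G n b \<and> (\<exists>js. legal G n x js \<and> b = fold (fire G n) js x)"
    then obtain js where js: "legal G n x js" "stable_config G n (fold (fire G n) js x)"
      and b: "b = fold (fire G n) js x" by auto
    have "firing_vec js = firing_vec is"
    proof (rule eq_vecI)
      fix k assume "k < dim_vec (firing_vec is)"
      then have "k < n" by (simp add: firing_vec_def)
      then show "firing_vec js $ k = firing_vec is $ k"
        using stable_firing_vec_le[OF x "is"(1) js] stable_firing_vec_le[OF x js(1) "is"]
        by (simp add: antisym)
    qed (simp add: firing_vec_def)
    then show "b = fold (fire G n) is x" using b fold_fire xc "is" js by simp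
  qed (use "is" in blast)
  then show ?thesis using that "is" fold_fire xc by simp
qed

section \<open>Comparison of weights\<close>

text \<open>Exchanging the sums weights each full row sum of \<open>\<Delta>\<close> by a
  non-negative number of firings, and these row sums are non-negative: firing creates no
  chips.\<close>

lemma weight_laplace_nonneg:
  assumes g: "g \<in> carrier_vec n" "\<And>j. j < n \<Longrightarrow> 0 \<le> g $ j"
  shows "0 \<le> weight (laplace g)"
proof -
  have "weight (laplace g) = (\<Sum>j<n. \<Sum>k<n. g $ k * \<Delta> $$ (k, j))"
    using g by (simp add: weight_def laplace_nth)
  also have "\<dots> = (\<Sum>k<n. g $ k * (\<Sum>j<n. \<Delta> $$ (k, j)))"
    by (subst sum.swap) (simp add: sum_distrib_left)
  also have "\<dots> \<ge> 0"
    using g by (intro sum_nonneg mult_nonneg_nonneg sum_laplacian_nonneg) auto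
  finally show ?thesis .
qed

lemma critical_firing_nonneg:
  assumes crit: "critical G n a" and stab: "stable_config G n b"
    and \<sigma>: "\<sigma> \<in> carrier_vec n" and b: "b = a - laplace \<sigma>" and k: "k < n"
  shows "0 \<le> \<sigma> $ k"
proof -
  have ac: "a \<in> carrier_vec n" using crit by (simp add: critical_def nonneg_config_def)
  have bc: "b \<in> carrier_vec n" using stab by (simp add: stable_config_def nonneg_config_def)
  obtain c where c: "nonneg_config n c" "nonneg_config n (b + c)" "a = stabilization G n (b + c)"
    using crit bc by (auto simp: critical_def)
  obtain "is" where "is": "legal G n (b + c) is" "a = b + c - laplace (firing_vec is)"
    using stabilization_legal[OF c(2)] c(3) by metis
  have cc: "c \<in> carrier_vec n" using c by (simp add: nonneg_config_def)
  let ?g = "firing_vec is + \<sigma>"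
  have gc: "?g \<in> carrier_vec n" using \<sigma> by simp
  have lap: "laplace ?g = laplace (firing_vec is) + laplace \<sigma>" using \<sigma> by (simp add: laplace_add)
  \<comment> \<open>The two relations between \<open>a\<close> and \<open>b\<close> are added, so
    that both configurations cancel.\<close>
  have comp: "laplace ?g $ j = c $ j" if j: "j < n" for j
  proof -
    have "a $ j = b $ j + c $ j - laplace (firing_vec is) $ j"
      using arg_cong[OF "is"(2), of "\<lambda>v. v $ j"] j cc bc by simp
    moreover have "b $ j = a $ j - laplace \<sigma> $ j"
      using arg_cong[OF b, of "\<lambda>v. v $ j"] j ac by simp
    ultimately show ?thesis using lap j by simp
  qed
  have gpos: "0 \<le> ?g $ j" if "j < n" for j
    using gc _ that by (rule laplace_inverse_nonneg) (use comp c in \<open>auto simp: nonneg_config_def\<close>)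
  \<comment> \<open>Thus \<open>?g\<close> leads from \<open>b + c\<close> to the stable
    \<open>b\<close>, possibly illegally, and is an admissible competitor to the legal sequence that
    leads to \<open>a\<close>.\<close>
  have "b + c - laplace ?g = b"
    using bc cc comp by (intro eq_vecI) auto
  then have "firing_vec is $ k \<le> ?g $ k"
    using stab bc cc gc gpos k by (intro legal_firing_vec_le[OF "is"(1)]) (auto simp: stable_config_def)
  then show ?thesis using \<sigma> k by simp
qed

end

theorem theorem1:
  fixes G :: "(nat, 'e) pre_digraph" and n :: nat and a b :: "int vec"
  assumes "fin_digraph G" and "loopfree_digraph G"
    and "verts G = {1..n + 1}" and "global_sink G (n + 1)"
    and "critical G n a"
    and "stable_config G n b" and "linearly_equivalent G n a b"
  shows "weight a \<ge> weight b"
proof -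
  interpret fin_digraph G by fact
  interpret sandpile G n by unfold_locales fact+
  obtain \<sigma> where \<sigma>: "\<sigma> \<in> carrier_vec n" "b = a - laplace \<sigma>"
    using assms(7) by (auto simp: linearly_equivalent_def laplace_def)
  have "weight b = weight a - weight (laplace \<sigma>)"
    using assms(5) \<sigma>
    by (auto simp: weight_def critical_def nonneg_config_def sum_subtractf)
  then show ?thesis
    using weight_laplace_nonneg[OF \<sigma>(1) critical_firing_nonneg[OF assms(5,6) \<sigma>]] by simp
qed

end
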